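(* Let $\alpha_1,\alpha_2,\alpha_3$ be three non-collinear null points, with lines $L_1\equiv\alpha_2\alpha_3$, $L_2\equiv\alpha_1\alpha_3$, $L_3\equiv\alpha_1\alpha_2$, and let $a$ be a point distinct from the dual points $L_1^\perp,L_2^\perp,L_3^\perp$. For $i=1,2,3$ let $b_i\equiv(aL_i^\perp)L_i$ be the base point at which the altitude line from $a$ to $L_i$ meets $L_i$, and suppose that $b_1,b_2,b_3$ are non-null, so that their quadrea is defined. Then $$\mathcal A(b_1,b_2,b_3)=1.$$
   Context: Let $\mathbb F$ be a field of characteristic not two. A 3-proportion $x:y:z$ is a triple of elements of $\mathbb F$, not all zero, up to a common non-zero scalar. A point $a=[x:y:z]$ and a line $L=(l:m:n)$ are both 3-proportions. The point $[x:y:z]$ and the line $(x:y:z)$ are dual to each other, written $a^\perp=L$, $L^\perp=a$. The point $[x:y:z]$ lies on the line $(l:m:n)$ when $lx+my-nz=0$. For distinct points $a,b$, the join $ab$ is the unique line through both; for distinct lines $L,M$, the meet $LM$ is the unique point lying on both. A point $[x:y:z]$ is null when $x^2+y^2-z^2=0$. For a point $a$ and a line $L$ with $a\neq L^\perp$, the altitude line from $a$ to $L$ is $aL^\perp$, the unique line through $a$ perpendicular to $L$ (lines $(l_1:m_1:n_1)$, $(l_2:m_2:n_2)$ are perpendicular when $l_1l_2+m_1m_2-n_1n_2=0$). The quadrea of three non-null points $a_i=[x_i:y_i:z_i]$, $i=1,2,3$, is $$\mathcal A(a_1,a_2,a_3)=-\frac{(x_1y_2z_3-x_1y_3z_2+x_2y_3z_1-x_3y_2z_1+x_3y_1z_2-x_2y_1z_3)^2}{(x_1^2+y_1^2-z_1^2)(x_2^2+y_2^2-z_2^2)(x_3^2+y_3^2-z_3^2)}.$$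 *)

theory Defs
  imports Main
begin

text \<open>
  The quotient is partial: only non-zero triples represent a 3-proportion, so the zero triple is
  excluded from the domain of the relation.
\<close>

definition proportional :: "'a::field \<times> 'a \<times> 'a \<Rightarrow> 'a \<times> 'a \<times> 'a \<Rightarrow> bool" where
  "proportional u v \<longleftrightarrow> u \<noteq> (0, 0, 0) \<and> v \<noteq> (0, 0, 0) \<and>
     (\<exists>c. c \<noteq> 0 \<and> v = (c * fst u, c * fst (snd u), c * snd (snd u)))"

lemma part_equivp_proportional: "part_equivp (proportional :: 'a::field \<times> 'a \<times> 'a \<Rightarrow> _)"
proof (rule part_equivpI)
  show "\<exists>u :: 'a \<times> 'a \<times> 'a. proportional u u"
    by (rule exI[of _ "(1, 1, 1)"]) (auto simp: proportional_def)
  show "symp (proportional :: 'a \<times> 'a \<times> 'a \<Rightarrow> _)"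
  proof (rule sympI)
    fix u v :: "'a \<times> 'a \<times> 'a"
    assume uv: "proportional u v"
    then obtain c where c: "c \<noteq> 0" "v = (c * fst u, c * fst (snd u), c * snd (snd u))"
      by (auto simp: proportional_def)
    then have "u = (inverse c * fst v, inverse c * fst (snd v), inverse c * snd (snd v))"
      by (cases u) (simp add: mult.assoc[symmetric])
    moreover have "inverse c \<noteq> 0" using c by simp
    ultimately show "proportional v u" using uv unfolding proportional_def by blast
  qed
  show "transp (proportional :: 'a \<times> 'a \<times> 'a \<Rightarrow> _)"
  proof (rule transpI)
    fix u v w :: "'a \<times> 'a \<times> 'a"
    assume uv: "proportional u v" and vw: "proportional v w"
    obtain c where c: "c \<noteq> 0" "v = (c * fst u, c * fst (snd u), c * snd (snd u))"
      using uv by (auto simp: proportional_def)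
    obtain d where d: "d \<noteq> 0" "w = (d * fst v, d * fst (snd v), d * snd (snd v))"
      using vw by (auto simp: proportional_def)
    have "w = ((d * c) * fst u, (d * c) * fst (snd u), (d * c) * snd (snd u))"
      using c d by (simp add: mult.assoc)
    moreover have "d * c \<noteq> 0" using c d by simp
    ultimately show "proportional u w" using uv vw unfolding proportional_def by blast
  qed
qed

declare [[typedef_overloaded]]

quotient_type 'a proportion = "'a::field \<times> 'a \<times> 'a" / partial: proportional
  by (rule part_equivp_proportional)

lift_definition incident :: "'a::field proportion \<Rightarrow> 'a proportion \<Rightarrow> bool"
  is "\<lambda>(x, y, z) (l, m, n). l * x + m * y - n * z = 0"
proof -
  fix p q r s :: "'a \<times> 'a \<times> 'a"
  assume pq: "proportional p q" and rs: "proportional r s"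
  obtain x y z l m n where e: "p = (x, y, z)" "r = (l, m, n)"
    by (cases p, cases r)
  obtain c where c: "c \<noteq> 0" "q = (c * x, c * y, c * z)"
    using pq e by (auto simp: proportional_def)
  obtain d where d: "d \<noteq> 0" "s = (d * l, d * m, d * n)"
    using rs e by (auto simp: proportional_def)
  have "(d * l) * (c * x) + (d * m) * (c * y) - (d * n) * (c * z)
        = (d * c) * (l * x + m * y - n * z)"
    by (simp add: algebra_simps)
  then show "(case p of (x, y, z) \<Rightarrow> \<lambda>(l, m, n). l * x + m * y - n * z = 0) r
           = (case q of (x, y, z) \<Rightarrow> \<lambda>(l, m, n). l * x + m * y - n * z = 0) s"
    using c(1) d(1) unfolding e c(2) d(2) prod.case by (simp del: right_minus_eq)
qed

lemma proportional_if_cross_zero: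
  fixes x y z x' y' z' :: "'a::field"
  assumes u: "(x, y, z) \<noteq> (0, 0, 0)" and v: "(x', y', z') \<noteq> (0, 0, 0)"
    and c: "y * z' = z * y'" "z * x' = x * z'" "x * y' = y * x'"
  shows "proportional (x, y, z) (x', y', z')"
proof -
  consider "x \<noteq> 0" | "y \<noteq> 0" | "z \<noteq> 0" using u by auto
  then have "\<exists>k. (x', y', z') = (k * x, k * y, k * z)"
  proof cases
    case 1
    then show ?thesis using c by (intro exI[of _ "x' / x"]) (simp add: field_simps)
  next
    case 2
    then show ?thesis using c by (intro exI[of _ "y' / y"]) (simp add: field_simps)
  next
    case 3
    then show ?thesis using c by (intro exI[of _ "z' / z"]) (simp add: field_simps)
  qed
  then obtain k where k: "(x', y', z') = (k * x, k * y, k * z)" by blast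
  moreover have "k \<noteq> 0" using k v by auto
  ultimately show ?thesis using u v by (auto simp: proportional_def)
qed

lemma proportion_obtain:
  obtains x y z where "(x, y, z) \<noteq> (0, 0, 0)" "p = abs_proportion (x, y, z)"
proof -
  have "\<exists>x y z. (x, y, z) \<noteq> (0, 0, 0) \<and> p = abs_proportion (x, y, z)"
  proof (induct p rule: proportion.abs_induct)
    case (1 t)
    then show ?case by (cases t) (auto simp: proportional_def)
  qed
  then show thesis using that by blast
qed

lemma proportional_refl: "u \<noteq> (0, 0, 0) \<Longrightarrow> proportional u u"
  by (cases u) (auto simp: proportional_def intro: exI[of _ 1])

lemma abs_proportion_eq: "proportional u v \<Longrightarrow> abs_proportion u = abs_proportion v"
  using Quotient_proportion by (rule Quotient_rel_abs)

lemma incident_abs: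
  assumes "(x, y, z) \<noteq> (0, 0, 0)" "(l, m, n) \<noteq> (0, 0, 0)"
  shows "incident (abs_proportion (x, y, z)) (abs_proportion (l, m, n)) \<longleftrightarrow> l * x + m * y - n * z = 0"
  using assms by (simp add: incident.abs_eq eq_onp_def proportional_refl)

lemma incident_commute: "incident p q \<longleftrightarrow> incident q p"
proof -
  obtain x y z where p: "(x, y, z) \<noteq> (0, 0, 0)" "p = abs_proportion (x, y, z)"
    by (rule proportion_obtain)
  obtain l m n where q: "(l, m, n) \<noteq> (0, 0, 0)" "q = abs_proportion (l, m, n)"
    by (rule proportion_obtain)
  show ?thesis using p q by (simp add: incident_abs mult.commute)
qed

lemma ex1_incident:
  assumes "p \<noteq> q"
  shows "\<exists>!r. incident p r \<and> incident q r"
proof -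
  obtain x y z where p: "(x, y, z) \<noteq> (0, 0, 0)" "p = abs_proportion (x, y, z)"
    by (rule proportion_obtain)
  obtain x' y' z' where q: "(x', y', z') \<noteq> (0, 0, 0)" "q = abs_proportion (x', y', z')"
    by (rule proportion_obtain)
  define l m n where "l = y * z' - z * y'" and "m = z * x' - x * z'" and "n = y * x' - x * y'"
  note lmn = l_def m_def n_def
  have nz: "(l, m, n) \<noteq> (0, 0, 0)"
  proof
    assume "(l, m, n) = (0, 0, 0)"
    then have "proportional (x, y, z) (x', y', z')"
      using p q by (intro proportional_if_cross_zero) (auto simp: lmn)
    then show False using assms p q abs_proportion_eq by blast
  qed
  show ?thesis
  proof (rule ex1I[of _ "abs_proportion (l, m, n)"])
    show "incident p (abs_proportion (l, m, n)) \<and> incident q (abs_proportion (l, m, n))"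
      using p q nz by (simp add: incident_abs) (simp add: lmn algebra_simps)
  next
    fix r assume r: "incident p r \<and> incident q r"
    obtain l' m' n' where r': "(l', m', n') \<noteq> (0, 0, 0)" "r = abs_proportion (l', m', n')"
      by (rule proportion_obtain)
    have e1: "l' * x + m' * y - n' * z = 0" and e2: "l' * x' + m' * y' - n' * z' = 0"
      using r p q r' by (simp_all add: incident_abs)
    have "m' * n - n' * m = x' * (l' * x + m' * y - n' * z) - x * (l' * x' + m' * y' - n' * z')"
      by (simp add: lmn algebra_simps)
    then have 1: "m' * n = n' * m" using e1 e2 by simp
    have "n' * l - l' * n = y' * (l' * x + m' * y - n' * z) - y * (l' * x' + m' * y' - n' * z')"
      by (simp add: lmn algebra_simps)
    then have 2: "n' * l = l' * n" using e1 e2 by simp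
    have "l' * m - m' * l = z * (l' * x' + m' * y' - n' * z') - z' * (l' * x + m' * y - n' * z)"
      by (simp add: lmn algebra_simps)
    then have 3: "l' * m = m' * l" using e1 e2 by simp
    show "r = abs_proportion (l, m, n)"
      unfolding r'(2)
      by (rule abs_proportion_eq, rule proportional_if_cross_zero[OF r'(1) nz 1 2 3])
  qed
qed

lift_definition isotropic :: "'a::field proportion \<Rightarrow> bool"
  is "\<lambda>(x, y, z). x\<^sup>2 + y\<^sup>2 - z\<^sup>2 = 0"
proof -
  fix p q :: "'a \<times> 'a \<times> 'a"
  assume pq: "proportional p q"
  obtain x y z where e: "p = (x, y, z)" by (cases p)
  obtain c where c: "c \<noteq> 0" "q = (c * x, c * y, c * z)"
    using pq e by (auto simp: proportional_def)
  have "(c * x)\<^sup>2 + (c * y)\<^sup>2 - (c * z)\<^sup>2 = c\<^sup>2 * (x\<^sup>2 + y\<^sup>2 - z\<^sup>2)"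
    by (simp add: algebra_simps power2_eq_square)
  then show "(case p of (x, y, z) \<Rightarrow> x\<^sup>2 + y\<^sup>2 - z\<^sup>2 = 0) = (case q of (x, y, z) \<Rightarrow> x\<^sup>2 + y\<^sup>2 - z\<^sup>2 = 0)"
    using c(1) unfolding e c(2) prod.case by (simp del: right_minus_eq)
qed

text \<open>
  For isotropic arguments the denominator vanishes and the value is \<open>0\<close> by the convention on
  division by zero; the quadrea is meaningful only for non-isotropic arguments.
\<close>

lift_definition proportion_quadrea ::
  "'a::field proportion \<Rightarrow> 'a proportion \<Rightarrow> 'a proportion \<Rightarrow> 'a"
  is "\<lambda>(x1, y1, z1) (x2, y2, z2) (x3, y3, z3).
        - ((x1 * y2 * z3 - x1 * y3 * z2 + x2 * y3 * z1
            - x3 * y2 * z1 + x3 * y1 * z2 - x2 * y1 * z3)\<^sup>2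
           / ((x1\<^sup>2 + y1\<^sup>2 - z1\<^sup>2) * (x2\<^sup>2 + y2\<^sup>2 - z2\<^sup>2) * (x3\<^sup>2 + y3\<^sup>2 - z3\<^sup>2)))"
proof -
  fix p1 q1 p2 q2 p3 q3 :: "'a \<times> 'a \<times> 'a"
  assume pq: "proportional p1 q1" "proportional p2 q2" "proportional p3 q3"
  obtain x1 y1 z1 x2 y2 z2 x3 y3 z3
    where e: "p1 = (x1, y1, z1)" "p2 = (x2, y2, z2)" "p3 = (x3, y3, z3)"
    by (cases p1, cases p2, cases p3)
  obtain c where c: "c \<noteq> 0" "q1 = (c * x1, c * y1, c * z1)"
    using pq(1) e by (auto simp: proportional_def)
  obtain d where d: "d \<noteq> 0" "q2 = (d * x2, d * y2, d * z2)"
    using pq(2) e by (auto simp: proportional_def)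
  obtain f where f: "f \<noteq> 0" "q3 = (f * x3, f * y3, f * z3)"
    using pq(3) e by (auto simp: proportional_def)
  let ?D = "\<lambda>x1 y1 z1 x2 y2 z2 x3 y3 z3. x1 * y2 * z3 - x1 * y3 * z2 + x2 * y3 * z1
            - x3 * y2 * z1 + x3 * y1 * z2 - x2 * y1 * z3 :: 'a"
  let ?Q = "\<lambda>x y z. x\<^sup>2 + y\<^sup>2 - z\<^sup>2 :: 'a"
  have D: "?D (c * x1) (c * y1) (c * z1) (d * x2) (d * y2) (d * z2) (f * x3) (f * y3) (f * z3)
           = (c * d * f) * ?D x1 y1 z1 x2 y2 z2 x3 y3 z3"
    by (simp add: algebra_simps)
  have Q: "?Q (k * x) (k * y) (k * z) = k\<^sup>2 * ?Q x y z" for k x y z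
    by (simp add: algebra_simps power2_eq_square)
  have P: "(c\<^sup>2 * A) * (d\<^sup>2 * B) * (f\<^sup>2 * C) = (c * d * f)\<^sup>2 * (A * B * C)" for A B C
    by (simp add: algebra_simps power2_eq_square)
  have "(c * d * f)\<^sup>2 \<noteq> 0" using c d f by simp
  then show "(case p1 of (x1, y1, z1) \<Rightarrow> \<lambda>(x2, y2, z2) (x3, y3, z3).
        - ((?D x1 y1 z1 x2 y2 z2 x3 y3 z3)\<^sup>2 / (?Q x1 y1 z1 * ?Q x2 y2 z2 * ?Q x3 y3 z3))) p2 p3
     = (case q1 of (x1, y1, z1) \<Rightarrow> \<lambda>(x2, y2, z2) (x3, y3, z3).
        - ((?D x1 y1 z1 x2 y2 z2 x3 y3 z3)\<^sup>2 / (?Q x1 y1 z1 * ?Q x2 y2 z2 * ?Q x3 y3 z3))) q2 q3"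
    unfolding e c(2) d(2) f(2) prod.case D Q P power_mult_distrib[of "c * d * f"]
    by simp
qed

text \<open>Points and lines are both 3-proportions, kept apart by a tag.\<close>

datatype 'a point = Point "'a::field proportion"
datatype 'a line = Line "'a::field proportion"

fun dual_line :: "'a::field point \<Rightarrow> 'a line" where
  "dual_line (Point p) = Line p"

fun dual_point :: "'a::field line \<Rightarrow> 'a point" where
  "dual_point (Line p) = Point p"

fun lies_on :: "'a::field point \<Rightarrow> 'a line \<Rightarrow> bool" where
  "lies_on (Point p) (Line q) = incident p q"

fun null_point :: "'a::field point \<Rightarrow> bool" where
  "null_point (Point p) = isotropic p"

fun quadrea :: "'a::field point \<Rightarrow> 'a point \<Rightarrow> 'a point \<Rightarrow> 'a" where
  "quadrea (Point p) (Point q) (Point r) = proportion_quadrea p q r"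

definition collinear :: "'a::field point \<Rightarrow> 'a point \<Rightarrow> 'a point \<Rightarrow> bool" where
  "collinear a b c \<longleftrightarrow> (\<exists>L. lies_on a L \<and> lies_on b L \<and> lies_on c L)"

definition join :: "'a::field point \<Rightarrow> 'a point \<Rightarrow> 'a line" where
  "join a b = (THE L. lies_on a L \<and> lies_on b L)"

definition meet :: "'a::field line \<Rightarrow> 'a line \<Rightarrow> 'a point" where
  "meet L M = (THE a. lies_on a L \<and> lies_on a M)"

lemma ex1_join:
  assumes "a \<noteq> b"
  shows "\<exists>!L. lies_on a L \<and> lies_on b L"
proof -
  obtain p q where ab: "a = Point p" "b = Point q" by (cases a, cases b)
  then obtain r where r: "incident p r" "incident q r"
    and u: "\<And>s. incident p s \<Longrightarrow> incident q s \<Longrightarrow> s = r"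
    using ex1_incident[of p q] assms by auto
  show ?thesis
  proof (rule ex1I[of _ "Line r"])
    show "lies_on a (Line r) \<and> lies_on b (Line r)" using ab r by simp
    show "L = Line r" if "lies_on a L \<and> lies_on b L" for L
      using that ab u by (cases L) simp
  qed
qed

lemma ex1_meet:
  assumes "L \<noteq> M"
  shows "\<exists>!a. lies_on a L \<and> lies_on a M"
proof -
  obtain p q where LM: "L = Line p" "M = Line q" by (cases L, cases M)
  then obtain r where r: "incident r p" "incident r q"
    and u: "\<And>s. incident s p \<Longrightarrow> incident s q \<Longrightarrow> s = r"
    using ex1_incident[of p q] assms by (auto simp: incident_commute)
  show ?thesis
  proof (rule ex1I[of _ "Point r"])
    show "lies_on (Point r) L \<and> lies_on (Point r) M" using LM r by simp
    show "a = Point r" if "lies_on a L \<and> lies_on a M" for a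
      using that LM u by (cases a) simp
  qed
qed

definition altitude :: "'a::field point \<Rightarrow> 'a line \<Rightarrow> 'a line" where
  "altitude a L = join a (dual_point L)"

definition base_point :: "'a::field point \<Rightarrow> 'a line \<Rightarrow> 'a point" where
  "base_point a L = meet (altitude a L) L"

end

theory Submission
  imports Defs
begin

text \<open>
  Write \<open>B\<close> for the bilinear form \<open>x x' + y y' - z z'\<close>, and let \<open>v\<^sub>1, v\<^sub>2, v\<^sub>3, u\<close> represent the null points
  and \<open>a\<close>. Put \<open>t\<^sub>i = B(u, v\<^sub>i)\<close> and \<open>g\<^sub>i\<^sub>j = B(v\<^sub>i, v\<^sub>j)\<close>. The altitude from \<open>a\<close> to \<open>L\<^sub>1\<close> is represented by
  \<open>t\<^sub>3 v\<^sub>2 - t\<^sub>2 v\<^sub>3\<close> and the base point \<open>b\<^sub>1\<close> by \<open>t\<^sub>3 v\<^sub>2 + t\<^sub>2 v\<^sub>3\<close>, with \<open>B(b\<^sub>1, b\<^sub>1) = 2 t\<^sub>2 t\<^sub>3 g\<^sub>2\<^sub>3\<close>; the other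
  two base points are obtained in the same way. Hence \<open>det(b\<^sub>1, b\<^sub>2, b\<^sub>3) = 2 t\<^sub>1 t\<^sub>2 t\<^sub>3 D\<close> with
  \<open>D = det(v\<^sub>1, v\<^sub>2, v\<^sub>3)\<close>, and the Gram determinant gives \<open>- D\<^sup>2 = 2 g\<^sub>1\<^sub>2 g\<^sub>1\<^sub>3 g\<^sub>2\<^sub>3\<close>. The factors \<open>t\<^sub>i\<close> and
  \<open>g\<^sub>i\<^sub>j\<close> cancel in the quadrea.
\<close>

text \<open>This form encodes both geometric notions at once: a point lies on a line when
  representatives are orthogonal, and a point is null when its representative is
  self-orthogonal.\<close>

fun mform :: "'a::field \<times> 'a \<times> 'a \<Rightarrow> 'a \<times> 'a \<times> 'a \<Rightarrow> 'a" where
  "mform (x, y, z) (x', y', z') = x * x' + y * y' - z * z'"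

fun lincomb :: "'a::field \<Rightarrow> 'a \<times> 'a \<times> 'a \<Rightarrow> 'a \<Rightarrow> 'a \<times> 'a \<times> 'a \<Rightarrow> 'a \<times> 'a \<times> 'a" where
  "lincomb c (x, y, z) d (x', y', z') = (c * x + d * x', c * y + d * y', c * z + d * z')"

fun det3 :: "'a::field \<times> 'a \<times> 'a \<Rightarrow> 'a \<times> 'a \<times> 'a \<Rightarrow> 'a \<times> 'a \<times> 'a \<Rightarrow> 'a" where
  "det3 (x1, y1, z1) (x2, y2, z2) (x3, y3, z3) =
     x1 * y2 * z3 - x1 * y3 * z2 + x2 * y3 * z1 - x3 * y2 * z1 + x3 * y1 * z2 - x2 * y1 * z3"

lemma mform_commute: "mform u v = mform v u"
  by (cases u; cases v) (simp add: mult.commute)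

lemma mform_lincomb: "mform u (lincomb c v d w) = c * mform u v + d * mform u w"
  by (cases u; cases v; cases w) (simp add: algebra_simps)

lemma mform_lincomb_left: "mform (lincomb c v d w) u = c * mform v u + d * mform w u"
  by (metis mform_commute mform_lincomb)

lemma mform_zero [simp]: "mform (0, 0, 0) u = 0" "mform u (0, 0, 0) = 0"
  by (cases u; simp)+

text \<open>The Gram matrix is \<open>M J M^T\<close> with \<open>J = diag(1, 1, -1)\<close>, so its
  determinant, expanded on the right, is minus the square of \<open>det M\<close>.\<close>

lemma det3_gram:
  "- (det3 u v w)\<^sup>2 =
     mform u u * mform v v * mform w w + 2 * (mform u v * mform u w * mform v w)
     - mform u u * (mform v w)\<^sup>2 - mform v v * (mform u w)\<^sup>2 - mform w w * (mform u v)\<^sup>2"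
  by (cases u; cases v; cases w) (simp add: power2_eq_square algebra_simps)

text \<open>The coefficient matrix with rows \<open>(0, t3, t2)\<close>, \<open>(t3, 0, t1)\<close>,
  \<open>(t2, t1, 0)\<close> has determinant \<open>2 * t1 * t2 * t3\<close>.\<close>

lemma det3_lincomb:
  "det3 (lincomb t3 v2 t2 v3) (lincomb t3 v1 t1 v3) (lincomb t2 v1 t1 v2) =
     2 * t1 * t2 * t3 * det3 v1 v2 v3"
  by (cases v1; cases v2; cases v3) (simp add: algebra_simps)

lemma point_obtain:
  obtains u where "u \<noteq> (0, 0, 0)" "a = Point (abs_proportion u)"
  by (cases a) (metis proportion_obtain)

lemma lies_on_abs:
  assumes "u \<noteq> (0, 0, 0)" "v \<noteq> (0, 0, 0)"
  shows "lies_on (Point (abs_proportion u)) (Line (abs_proportion v)) \<longleftrightarrow> mform u v = 0"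
  using assms by (cases u; cases v) (simp add: incident_abs mult.commute)

lemma null_point_abs:
  assumes "u \<noteq> (0, 0, 0)"
  shows "null_point (Point (abs_proportion u)) \<longleftrightarrow> mform u u = 0"
  using assms
  by (cases u) (simp add: isotropic.abs_eq eq_onp_def proportional_refl power2_eq_square)

lemma quadrea_abs:
  assumes "u \<noteq> (0, 0, 0)" "v \<noteq> (0, 0, 0)" "w \<noteq> (0, 0, 0)"
  shows "quadrea (Point (abs_proportion u)) (Point (abs_proportion v)) (Point (abs_proportion w)) =
    - ((det3 u v w)\<^sup>2 / (mform u u * mform v v * mform w w))"
  using assms
  by (cases u; cases v; cases w)
    (simp add: proportion_quadrea.abs_eq eq_onp_def proportional_refl power2_eq_square)

lemma join_eqI:
  assumes "a \<noteq> b" "lies_on a L" "lies_on b L"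
  shows "join a b = L"
  unfolding join_def using ex1_join[OF assms(1)] assms(2,3) by (intro the1_equality) auto

lemma meet_eqI:
  assumes "L \<noteq> M" "lies_on a L" "lies_on a M"
  shows "meet L M = a"
  unfolding meet_def using ex1_meet[OF assms(1)] assms(2,3) by (intro the1_equality) auto

lemma not_collinear_imp_distinct:
  assumes "null_point a" "\<not> collinear a b c"
  shows "a \<noteq> b"
proof
  assume "a = b"
  show False
  proof (cases "a = c")
    case True
    \<comment> \<open>a null point lies on its own dual line\<close>
    obtain u where u: "u \<noteq> (0, 0, 0)" "a = Point (abs_proportion u)" by (rule point_obtain)
    have "lies_on a (Line (abs_proportion u))"
      using assms(1) unfolding u(2) lies_on_abs[OF u(1) u(1)] null_point_abs[OF u(1)] .
    with \<open>a = b\<close> True assms(2) show False by (auto simp: collinear_def)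
  next
    case False
    with ex1_join[of a c] \<open>a = b\<close> assms(2) show False by (auto simp: collinear_def)
  qed
qed

lemma det3_eq_0_imp_collinear:
  assumes nz: "u \<noteq> (0, 0, 0)" "v \<noteq> (0, 0, 0)" "w \<noteq> (0, 0, 0)"
    and ne: "abs_proportion u \<noteq> abs_proportion v"
    and det: "det3 u v w = 0"
  shows "collinear (Point (abs_proportion u)) (Point (abs_proportion v)) (Point (abs_proportion w))"
proof -
  obtain x y z x' y' z' x'' y'' z''
    where e: "u = (x, y, z)" "v = (x', y', z')" "w = (x'', y'', z'')"
    by (cases u; cases v; cases w)
  \<comment> \<open>The Euclidean cross product with its last coordinate negated, so that pairing
    with it by \<open>mform\<close> gives the triple determinant.\<close>
  define l where "l = (y * z' - z * y', z * x' - x * z', y * x' - x * y')"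
  have "l \<noteq> (0, 0, 0)"
  proof
    assume "l = (0, 0, 0)"
    then have "proportional u v"
      using nz unfolding e l_def by (intro proportional_if_cross_zero) auto
    with ne show False using abs_proportion_eq by blast
  qed
  moreover have "mform u l = 0" "mform v l = 0"
    by (simp_all add: e l_def algebra_simps)
  moreover have "mform w l = det3 u v w"
    by (simp add: e l_def algebra_simps)
  ultimately show ?thesis
    unfolding collinear_def using nz det
    by (intro exI[of _ "Line (abs_proportion l)"]) (simp add: lies_on_abs del: lies_on.simps)
qed

text \<open>As \<open>v\<close> and \<open>w\<close> are null, \<open>c v + d w\<close> pairs with
  \<open>v\<close> to \<open>d * mform v w\<close> and with \<open>w\<close> to
  \<open>c * mform v w\<close>. Hence \<open>s v + t w\<close> and \<open>s v - t w\<close> are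
  orthogonal, and the latter is orthogonal to \<open>u\<close>.\<close>

lemma base_point_null_chord:
  fixes u v w :: "'a::field \<times> 'a \<times> 'a"
  defines "b \<equiv> lincomb (mform u w) v (mform u v) w"
    and "L \<equiv> join (Point (abs_proportion v)) (Point (abs_proportion w))"
  assumes nz: "u \<noteq> (0, 0, 0)" "v \<noteq> (0, 0, 0)" "w \<noteq> (0, 0, 0)"
    and null: "mform v v = 0" "mform w w = 0" and g: "mform v w \<noteq> 0"
    and not_dual: "Point (abs_proportion u) \<noteq> dual_point L"
  shows "b \<noteq> (0, 0, 0)" "base_point (Point (abs_proportion u)) L = Point (abs_proportion b)"
proof -
  define s t where "s = mform u w" and "t = mform u v"
  define m where "m = lincomb s v (- t) w"
  have sg: "mform w v = mform v w" by (rule mform_commute)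
  \<comment> \<open>A null point lies on its own dual line, so equal points would force
    \<open>mform v w = 0\<close>.\<close>
  have dist: "Point (abs_proportion v) \<noteq> Point (abs_proportion w)"
    using null_point_abs lies_on_abs nz null g by metis
  obtain l where l: "l \<noteq> (0, 0, 0)" "L = Line (abs_proportion l)"
    by (cases L) (metis proportion_obtain)
  have "lies_on (Point (abs_proportion v)) L \<and> lies_on (Point (abs_proportion w)) L"
    unfolding L_def join_def by (rule theI'[OF ex1_join[OF dist]])
  then have vl: "mform v l = 0" "mform w l = 0"
    unfolding l(2) lies_on_abs[OF nz(2) l(1)] lies_on_abs[OF nz(3) l(1)] by blast+
  \<comment> \<open>Otherwise the dual line of the point \<open>u\<close> would pass through both
    null points and so equal \<open>L\<close>.\<close>
  have st: "\<not> (s = 0 \<and> t = 0)"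
  proof
    assume "s = 0 \<and> t = 0"
    then have "L = Line (abs_proportion u)"
      unfolding L_def using dist nz
      by (intro join_eqI) (simp_all add: lies_on_abs s_def t_def mform_commute del: lies_on.simps)
    with not_dual show False by simp
  qed
  have bv: "mform b v = t * mform v w" "mform b w = s * mform v w"
    and mv: "mform m v = - t * mform v w" "mform m w = s * mform v w"
    by (simp_all add: b_def m_def s_def t_def mform_lincomb_left null sg)
  show b: "b \<noteq> (0, 0, 0)" using bv st g by auto
  have m: "m \<noteq> (0, 0, 0)" using mv st g by auto
  have alt: "altitude (Point (abs_proportion u)) L = Line (abs_proportion m)"
    unfolding altitude_def
  proof (rule join_eqI[OF not_dual])
    show "lies_on (Point (abs_proportion u)) (Line (abs_proportion m))"
      using nz m by (simp add: lies_on_abs m_def mform_lincomb s_def t_def del: lies_on.simps)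
    show "lies_on (dual_point L) (Line (abs_proportion m))"
      using l m vl by (simp add: lies_on_abs m_def mform_lincomb mform_commute[of l] del: lies_on.simps)
  qed
  show "base_point (Point (abs_proportion u)) L = Point (abs_proportion b)"
    unfolding base_point_def alt
  proof (rule meet_eqI)
    \<comment> \<open>Every representative of \<open>L\<close> is orthogonal to \<open>v\<close> and
      \<open>w\<close>, whereas by \<open>mv\<close> and \<open>st\<close> the vector
      \<open>m\<close> is not.\<close>
    show "Line (abs_proportion m) \<noteq> L"
    proof
      assume "Line (abs_proportion m) = L"
      then have "mform v m = 0" "mform w m = 0"
        using vl lies_on_abs l m nz by metis+
      then show False using mv st g by (simp add: mform_commute[of m])
    qed
    show "lies_on (Point (abs_proportion b)) (Line (abs_proportion m))"
      using b m by (simp add: lies_on_abs m_def mform_lincomb bv del: lies_on.simps)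
    show "lies_on (Point (abs_proportion b)) L"
      using b l vl by (simp add: lies_on_abs b_def mform_lincomb_left del: lies_on.simps)
  qed
qed

lemma two_neq_0_if_CHAR_neq_2:
  assumes "CHAR('a::field) \<noteq> 2"
  shows "(2::'a) \<noteq> 0"
proof
  assume "(2::'a) = 0"
  then have "of_nat 2 = (0::'a)" by simp
  then have "CHAR('a) dvd 2" by (simp only: of_nat_eq_0_iff_char_dvd)
  then have "CHAR('a) \<le> 2" "CHAR('a) \<noteq> 0" by (auto dest: dvd_imp_le intro!: gr0I)
  moreover have "CHAR('a) \<noteq> 1" by simp
  ultimately show False using assms by linarith
qed

theorem theorem86:
  fixes \<alpha>1 \<alpha>2 \<alpha>3 a b1 b2 b3 :: "'a::field point" and L1 L2 L3 :: "'a line"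
  assumes char: "CHAR('a) \<noteq> 2"
    and null: "null_point \<alpha>1" "null_point \<alpha>2" "null_point \<alpha>3"
    and non_collinear: "\<not> collinear \<alpha>1 \<alpha>2 \<alpha>3"
    and lines: "L1 = join \<alpha>2 \<alpha>3" "L2 = join \<alpha>1 \<alpha>3" "L3 = join \<alpha>1 \<alpha>2"
    and not_dual: "a \<noteq> dual_point L1" "a \<noteq> dual_point L2" "a \<noteq> dual_point L3"
    and bases: "b1 = base_point a L1" "b2 = base_point a L2" "b3 = base_point a L3"
    and non_null: "\<not> null_point b1" "\<not> null_point b2" "\<not> null_point b3"
  shows "quadrea b1 b2 b3 = 1"
proof -
  obtain v1 where v1: "v1 \<noteq> (0, 0, 0)" "\<alpha>1 = Point (abs_proportion v1)" by (rule point_obtain)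
  obtain v2 where v2: "v2 \<noteq> (0, 0, 0)" "\<alpha>2 = Point (abs_proportion v2)" by (rule point_obtain)
  obtain v3 where v3: "v3 \<noteq> (0, 0, 0)" "\<alpha>3 = Point (abs_proportion v3)" by (rule point_obtain)
  obtain u where u: "u \<noteq> (0, 0, 0)" "a = Point (abs_proportion u)" by (rule point_obtain)
  define t1 t2 t3 where "t1 = mform u v1" and "t2 = mform u v2" and "t3 = mform u v3"
  define g12 g13 g23 where "g12 = mform v1 v2" and "g13 = mform v1 v3" and "g23 = mform v2 v3"
  define D where "D = det3 v1 v2 v3"
  have q: "mform v1 v1 = 0" "mform v2 v2 = 0" "mform v3 v3 = 0"
    using null unfolding v1(2) v2(2) v3(2) null_point_abs[OF v1(1)] null_point_abs[OF v2(1)]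
      null_point_abs[OF v3(1)] .
  have "\<alpha>1 \<noteq> \<alpha>2" using null(1) non_collinear by (rule not_collinear_imp_distinct)
  then have "D \<noteq> 0"
    using det3_eq_0_imp_collinear[OF v1(1) v2(1) v3(1)] non_collinear v1 v2 v3
    unfolding D_def by blast
  moreover have gram: "- D\<^sup>2 = 2 * (g12 * g13 * g23)"
    unfolding D_def det3_gram by (simp add: q g12_def g13_def g23_def)
  \<comment> \<open>No factor of the nonzero product \<open>- D^2\<close> can vanish.\<close>
  ultimately have g: "g12 \<noteq> 0" "g13 \<noteq> 0" "g23 \<noteq> 0" by auto
  note base = base_point_null_chord[OF u(1)]
  note B1 = base[OF v2(1) v3(1) q(2,3) g(3)[unfolded g23_def], folded t2_def t3_def]
  note B2 = base[OF v1(1) v3(1) q(1,3) g(2)[unfolded g13_def], folded t1_def t3_def]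
  note B3 = base[OF v1(1) v2(1) q(1,2) g(1)[unfolded g12_def], folded t1_def t2_def]
  define w1 w2 w3 where "w1 = lincomb t3 v2 t2 v3" and "w2 = lincomb t3 v1 t1 v3"
    and "w3 = lincomb t2 v1 t1 v2"
  have w: "w1 \<noteq> (0, 0, 0)" "w2 \<noteq> (0, 0, 0)" "w3 \<noteq> (0, 0, 0)"
    and b: "b1 = Point (abs_proportion w1)" "b2 = Point (abs_proportion w2)"
      "b3 = Point (abs_proportion w3)"
    using B1 B2 B3 not_dual bases lines v1 v2 v3 u unfolding w1_def w2_def w3_def by metis+
  have Q: "mform w1 w1 = 2 * t2 * t3 * g23" "mform w2 w2 = 2 * t1 * t3 * g13"
      "mform w3 w3 = 2 * t1 * t2 * g12"
    unfolding w1_def w2_def w3_def mform_lincomb mform_lincomb_left q g12_def g13_def g23_def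
      mform_commute[of v2 v1] mform_commute[of v3 v1] mform_commute[of v3 v2]
    by (simp_all add: algebra_simps)
  \<comment> \<open>By \<open>Q\<close> these two values contain the factors \<open>t2\<close>,
    \<open>t3\<close> and \<open>t1\<close>, \<open>t3\<close>, which covers all three.\<close>
  have "mform w1 w1 \<noteq> 0" "mform w2 w2 \<noteq> 0"
    using non_null(1,2) unfolding b null_point_abs[OF w(1)] null_point_abs[OF w(2)] by blast+
  then have t: "t1 \<noteq> 0" "t2 \<noteq> 0" "t3 \<noteq> 0" by (auto simp: Q)
  have "det3 w1 w2 w3 = 2 * t1 * t2 * t3 * D"
    unfolding w1_def w2_def w3_def D_def by (rule det3_lincomb)
  then have "- (det3 w1 w2 w3)\<^sup>2 = (2 * t1 * t2 * t3)\<^sup>2 * - D\<^sup>2"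
    by (simp add: power_mult_distrib)
  \<comment> \<open>Both sides equal 8 times the squares of the \<open>t\<close>'s times
    \<open>g12 * g13 * g23\<close>.\<close>
  also have "\<dots> = mform w1 w1 * mform w2 w2 * mform w3 w3"
    unfolding gram Q by (simp add: power2_eq_square)
  finally have "- (det3 w1 w2 w3)\<^sup>2 = mform w1 w1 * mform w2 w2 * mform w3 w3" .
  moreover have "mform w1 w1 * mform w2 w2 * mform w3 w3 \<noteq> 0"
    using t g two_neq_0_if_CHAR_neq_2[OF char] unfolding Q mult_eq_0_iff by blast
  ultimately show ?thesis
    unfolding b quadrea_abs[OF w] minus_divide_left by (metis divide_self)
qed

end
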